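(* Let $S$ be a finite set and let $\geq$ be an acceptance preorder on $2^S$. Then there exists a family $F(\geq)$ of complete acceptance preorders on $2^S$ such that for all $A,B\subseteq S$: $$A\geq B \iff A\geq_f B \text{ for every } \geq_f\,\in F(\geq).$$
   Context: $S$ is a finite set of states; events are subsets of $S$. For a relation $\geq$ on $2^S$, its strict part is: $A>B$ iff $A\geq B$ and not $B\geq A$. A relation $\geq$ on $2^S$ is an acceptance preorder if it satisfies: (T) $A\geq B$ and $B\geq C$ imply $A\geq C$; (MI) $A\subseteq B$ implies $B\geq A$; (Ac) for all pairwise disjoint $A,B,C$: $A\cup B>C$ and $A\cup C>B$ imply $A>B\cup C$. It need not be complete. It is complete if for all $A,B\subseteq S$, $A\geq B$ or $B\geq A$. *)

theory Defs
  imports Main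
begin

text \<open>
  A relation on the events of \<open>S\<close> is a set of pairs \<open>R \<subseteq> Pow S \<times> Pow S\<close>;
  \<open>(A, B) \<in> R\<close> stands for \<open>A \<ge> B\<close>, so the larger event comes first.
\<close>

definition strict_part :: "'a rel \<Rightarrow> 'a rel" where
  "strict_part R = {(x, y). (x, y) \<in> R \<and> (y, x) \<notin> R}"

definition acceptance_preorder :: "'a set \<Rightarrow> 'a set rel \<Rightarrow> bool" where
  "acceptance_preorder S R \<longleftrightarrow>
     R \<subseteq> Pow S \<times> Pow S \<and>
     trans R \<and>
     (\<forall>A B. A \<subseteq> B \<and> B \<subseteq> S \<longrightarrow> (B, A) \<in> R) \<and>
     (\<forall>A B C. A \<subseteq> S \<and> B \<subseteq> S \<and> C \<subseteq> S \<and>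
        A \<inter> B = {} \<and> A \<inter> C = {} \<and> B \<inter> C = {} \<and>
        (A \<union> B, C) \<in> strict_part R \<and> (A \<union> C, B) \<in> strict_part R \<longrightarrow>
        (A, B \<union> C) \<in> strict_part R)"

definition complete_on_events :: "'a set \<Rightarrow> 'a set rel \<Rightarrow> bool" where
  "complete_on_events S R \<longleftrightarrow> (\<forall>A\<subseteq>S. \<forall>B\<subseteq>S. (A, B) \<in> R \<or> (B, A) \<in> R)"

end

theory Submission
  imports Defs
begin

text \<open>
  It suffices to extend the preorder, for each pair with \<open>\<not> A \<ge> B\<close>, to a complete acceptance
  preorder in which still \<open>\<not> A \<ge> B\<close>; induct on \<open>S\<close>. Only disjoint events matter for (Ac).

  If \<open>\<not> S - B \<ge> B\<close>, choose an inclusion-minimal \<open>J \<subseteq> B\<close> with \<open>\<not> S - J \<ge> J\<close>. By (Ac), either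
  the events containing \<open>J\<close> are closed under passing to larger events, or all events meeting but
  not containing \<open>J\<close> are equivalent to \<open>J\<close>. Rank the events by whether they contain
  (respectively meet) \<open>J\<close>, and then by whether they are \<open>\<ge> B\<close>.

  If \<open>S - B \<ge> B\<close>, enlarge \<open>A\<close> to a maximal event that is not \<open>\<ge> B\<close>, and let \<open>N\<close> add to it all
  points \<open>k\<close> with \<open>A \<ge> {k}\<close>. By (Ac), everything below a subset of \<open>N\<close> is a subset of
  \<open>N\<close>, and \<open>N \<noteq> S\<close>. So one may put all events not inside \<open>N\<close> on top and recurse into \<open>N\<close>.
\<close>

section \<open>Rules for acceptance preorders\<close>

lemma acceptance_preorderI:
  assumes "R \<subseteq> Pow S \<times> Pow S" "trans R"
    and "\<And>A B. A \<subseteq> B \<Longrightarrow> B \<subseteq> S \<Longrightarrow> (B, A) \<in> R"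
    and "\<And>A B C. A \<subseteq> S \<Longrightarrow> B \<subseteq> S \<Longrightarrow> C \<subseteq> S \<Longrightarrow> A \<inter> B = {} \<Longrightarrow> A \<inter> C = {} \<Longrightarrow> B \<inter> C = {} \<Longrightarrow>
      (A \<union> B, C) \<in> strict_part R \<Longrightarrow> (A \<union> C, B) \<in> strict_part R \<Longrightarrow>
      (A, B \<union> C) \<in> strict_part R"
  shows "acceptance_preorder S R"
  using assms by (simp add: acceptance_preorder_def)

locale acceptance =
  fixes S :: "'a set" and R :: "'a set rel"
  assumes acceptance_preorder: "acceptance_preorder S R"
begin

lemma carrier: "(X, Y) \<in> R \<Longrightarrow> X \<subseteq> S \<and> Y \<subseteq> S"
  using acceptance_preorder by (auto simp: acceptance_preorder_def)

lemma transitive: "(X, Y) \<in> R \<Longrightarrow> (Y, Z) \<in> R \<Longrightarrow> (X, Z) \<in> R"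
  using acceptance_preorder transD[of R X Y Z] by (simp add: acceptance_preorder_def)

lemma subset_rel: "Y \<subseteq> X \<Longrightarrow> X \<subseteq> S \<Longrightarrow> (X, Y) \<in> R"
  using acceptance_preorder by (simp add: acceptance_preorder_def)

lemma mono_left: "(X, Y) \<in> R \<Longrightarrow> X \<subseteq> X' \<Longrightarrow> X' \<subseteq> S \<Longrightarrow> (X', Y) \<in> R"
  using transitive[of X' X Y] subset_rel[of X X'] by simp

lemma mono_right: "(X, Y) \<in> R \<Longrightarrow> Y' \<subseteq> Y \<Longrightarrow> (X, Y') \<in> R"
  using transitive[of X Y Y'] subset_rel[of Y' Y] carrier[of X Y] by simp

text \<open>\<open>X\<close>, \<open>Y\<close>, \<open>Z\<close> stand for the unions so that (Ac)
  also applies when a union has another name, such as \<open>J\<close>. Strictness is split into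
  memberships because most uses need only half of the conclusion.\<close>

lemma accept:
  assumes "A \<subseteq> S" "B \<subseteq> S" "C \<subseteq> S" "A \<inter> B = {}" "A \<inter> C = {}" "B \<inter> C = {}"
    and "A \<union> B = X" "A \<union> C = Y" "B \<union> C = Z"
    and "(X, C) \<in> R" "(C, X) \<notin> R" "(Y, B) \<in> R" "(B, Y) \<notin> R"
  shows "(A, Z) \<in> R" "(Z, A) \<notin> R"
proof -
  have "(A \<union> B, C) \<in> strict_part R" "(A \<union> C, B) \<in> strict_part R"
    using assms by (simp_all add: strict_part_def)
  then have "(A, B \<union> C) \<in> strict_part R"
    using acceptance_preorder assms(1-6) unfolding acceptance_preorder_def by simp
  then show "(A, Z) \<in> R" "(Z, A) \<notin> R"
    using assms(9) by (simp_all add: strict_part_def)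
qed

section \<open>Minimal events not dominated by their complement\<close>

text \<open>Apply (Ac) to partitions of \<open>S\<close> into \<open>S - J\<close> and two parts of
  \<open>J\<close>. Minimality forbids a proper part of \<open>J\<close> to beat its complement
  strictly, and \<open>S - J\<close> is not \<ge> \<open>J\<close>. These obstructions make both
  parts \<ge> \<open>J\<close>, then every single state of \<open>J\<close>.\<close>

lemma minimal_undominated:
  assumes J: "J \<subseteq> S" "(S - J, J) \<notin> R"
    and minimal: "\<And>J'. J' \<subset> J \<Longrightarrow> (S - J', J') \<in> R"
    and X: "(X, J) \<in> R" "\<not> J \<subseteq> X"
  shows meets_rel: "Y \<subseteq> S \<Longrightarrow> Y \<inter> J \<noteq> {} \<Longrightarrow> (Y, J) \<in> R"
    and rel_not_contains: "Y \<subseteq> S \<Longrightarrow> \<not> J \<subseteq> Y \<Longrightarrow> (J, Y) \<in> R"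
proof -
  define C where "C = S - J"
  define A where "A = X \<inter> J"
  define B where "B = J - X"
  have AB: "A \<union> B = J" "B \<union> A = J" and dj: "A \<inter> B = {}" "A \<inter> C = {}" "B \<inter> C = {}"
    and sub: "A \<subseteq> S" "B \<subseteq> S" "C \<subseteq> S"
    using J by (auto simp: A_def B_def C_def)
  have CJ: "(C, J) \<notin> R" using J by (simp add: C_def)
  have XS: "X \<subseteq> S" using X carrier by blast
  have B_ne: "B \<noteq> {}" using X by (auto simp: B_def)
  have A_ne: "A \<noteq> {}"
  proof
    assume "A = {}"
    then have "X \<subseteq> C" using XS by (auto simp: A_def C_def)
    then show False using CJ mono_left[OF X(1)] sub by simp
  qed
  have part: "S - A = C \<union> B" "S - B = C \<union> A"
    using AB dj J by (auto simp: C_def)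
  have CBA: "(C \<union> B, A) \<in> R"
    using minimal[of A] part B_ne AB dj by auto
  have "(C \<union> A, J) \<in> R"
    using mono_left[OF X(1), of "C \<union> A"] XS sub by (auto simp: A_def C_def)
  then have CAB: "(C \<union> A, B) \<in> R" and CAJ: "(C \<union> A, J) \<in> R"
    using mono_right[of "C \<union> A" J B] AB by auto
  have JA: "(J, A) \<in> R" and JB: "(J, B) \<in> R"
    using subset_rel[of A J] subset_rel[of B J] J AB by auto
  \<comment> \<open>Otherwise \<open>C \<union> A\<close> > \<open>B\<close>. If also
    \<open>C \<union> B\<close> > \<open>A\<close>, then (Ac) gives \<open>C\<close> >
    \<open>J\<close>. If not, \<open>A\<close> \<ge> \<open>C \<union> B\<close>, hence
    \<open>J\<close> > \<open>C\<close>, and (Ac) gives \<open>A\<close> >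
    \<open>B \<union> C\<close>, against minimality at \<open>A\<close>.\<close>
  have BCA: "(B, C \<union> A) \<in> R"
  proof (rule ccontr)
    assume n: "(B, C \<union> A) \<notin> R"
    have ACB: "(A, C \<union> B) \<in> R"
    proof (rule ccontr)
      assume m: "(A, C \<union> B) \<notin> R"
      have "(C, J) \<in> R"
        by (rule accept(1)[of C A B "C \<union> A" "C \<union> B"])
          (use n m CAB CBA AB dj sub in \<open>simp_all add: Int_commute\<close>)
      then show False using CJ by simp
    qed
    then have "(J, C) \<in> R"
      using mono_right[OF transitive[OF JA ACB]] by simp
    then have "(C \<union> B, A) \<notin> R"
      by (intro accept(2)[of A B C J "C \<union> A"]) (use n CAB AB CJ dj sub in auto)
    then show False using CBA by simp
  qed
  have BJ: "(B, J) \<in> R" using transitive[OF BCA CAJ] .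
  have JC: "(J, C) \<in> R" using mono_right[OF transitive[OF JB BCA]] by simp
  have ACB: "(A, C \<union> B) \<in> R"
  proof (rule ccontr)
    assume "(A, C \<union> B) \<notin> R"
    then have "(C \<union> A, B) \<notin> R"
      by (intro accept(2)[of B A C J "C \<union> B"]) (use JC CBA AB CJ dj sub in auto)
    then show False using CAB by simp
  qed
  have AJ: "(A, J) \<in> R" using transitive[OF mono_right[OF ACB] BJ] by simp
  \<comment> \<open>The rest \<open>J - {j}\<close> contains \<open>A\<close> or \<open>B\<close>,
    so it is \<ge> \<open>J\<close>. Were \<open>{j}\<close> not \<ge> \<open>J\<close>, then (Ac)
    together with \<open>J\<close> > \<open>C\<close> would give \<open>J - {j}\<close> >
    \<open>{j} \<union> C\<close>, against minimality.\<close>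
  have point: "({j}, J) \<in> R" if j: "j \<in> J" for j
  proof (rule ccontr)
    assume n: "({j}, J) \<notin> R"
    have rest: "(J - {j}, J) \<in> R"
    proof (cases "j \<in> A")
      case True
      then have "B \<subseteq> J - {j}" using AB dj by auto
      then show ?thesis using mono_left[OF BJ] J by auto
    next
      case False
      then have "A \<subseteq> J - {j}" using AB by auto
      then show ?thesis using mono_left[OF AJ] J by auto
    qed
    have restC: "((J - {j}) \<union> C, J) \<in> R"
      using mono_left[OF rest, of "J - {j} \<union> C"] J sub by auto
    have "(J - {j} \<union> C, {j}) \<in> R" using mono_right[OF restC] j by simp
    moreover have "({j}, J - {j} \<union> C) \<notin> R" using n transitive[OF _ restC] by auto
    ultimately have "({j} \<union> C, J - {j}) \<notin> R"
      by (intro accept(2)[of "J - {j}" "{j}" C J "J - {j} \<union> C"])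
        (use JC CJ j J sub in \<open>auto simp: C_def\<close>)
    moreover have "S - (J - {j}) = {j} \<union> C" using j J by (auto simp: C_def)
    moreover have "(S - (J - {j}), J - {j}) \<in> R" using minimal[of "J - {j}"] j by blast
    ultimately show False by simp
  qed
  have meets: "(Y, J) \<in> R" if "Y \<subseteq> S" "Y \<inter> J \<noteq> {}" for Y
  proof -
    obtain j where "j \<in> Y" "j \<in> J" using \<open>Y \<inter> J \<noteq> {}\<close> by blast
    then show ?thesis using mono_left[OF point, of j Y] that by simp
  qed
  show "(Y, J) \<in> R" if "Y \<subseteq> S" "Y \<inter> J \<noteq> {}" using meets that .
  show "(J, Y) \<in> R" if Y: "Y \<subseteq> S" "\<not> J \<subseteq> Y"
  proof (cases "Y \<inter> J = {}")
    case True
    then have "Y \<subseteq> C" using Y by (auto simp: C_def)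
    then show ?thesis using mono_right[OF JC] by simp
  next
    case False
    define D where "D = Y \<inter> J"
    define E where "E = J - Y"
    have DE: "D \<union> E = J" and dj': "D \<inter> E = {}" "D \<inter> C = {}" "E \<inter> C = {}"
      and sub': "D \<subseteq> S" "E \<subseteq> S" and "D \<subset> J" and YDC: "Y \<subseteq> D \<union> C"
      using Y J by (auto simp: D_def E_def C_def)
    have part': "S - D = E \<union> C" using J by (auto simp: D_def E_def C_def)
    have "(D \<union> C, J) \<in> R"
      using meets[of "D \<union> C"] sub sub' False by (auto simp: D_def)
    then have DCE: "(D \<union> C, E) \<in> R" using mono_right[of "D \<union> C" J E] DE by auto
    \<comment> \<open>Otherwise \<open>D \<union> C\<close> > \<open>E\<close>; since
      \<open>D \<union> E = J\<close> > \<open>C\<close>, (Ac) gives \<open>D\<close> >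
      \<open>E \<union> C\<close>, against minimality at \<open>D\<close>.\<close>
    have "(E, D \<union> C) \<in> R"
    proof (rule ccontr)
      assume "(E, D \<union> C) \<notin> R"
      then have "(E \<union> C, D) \<notin> R"
        by (intro accept(2)[of D E C J "D \<union> C"])
          (use DCE DE JC CJ dj' sub sub' in auto)
      then show False using minimal[OF \<open>D \<subset> J\<close>] part' by simp
    qed
    then have "(E, Y) \<in> R" using mono_right[OF _ YDC] by simp
    then show ?thesis using mono_left[of E Y J] J DE by auto
  qed
qed

section \<open>Proper subsets of \<open>S\<close> closed under passing to smaller events\<close>

text \<open>By maximality every proper enlargement of \<open>A\<close> is strictly above
  \<open>A\<close>, which supplies strict premises for (Ac). That \<open>S - B\<close> \<ge>
  \<open>B\<close> serves to show \<open>N \<noteq> S\<close>.\<close>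

lemma lower_closed_above_maximal:
  assumes fin: "finite S" and A: "A \<subseteq> S" "(A, B) \<notin> R" and B: "B \<subseteq> S"
    and maximal: "\<And>X. A \<subset> X \<Longrightarrow> X \<subseteq> S \<Longrightarrow> (X, B) \<in> R"
    and dominated: "(S - B, B) \<in> R"
  shows "\<exists>N. A \<subseteq> N \<and> N \<subset> S \<and> (\<forall>X Y. (X, Y) \<in> R \<longrightarrow> X \<subseteq> N \<longrightarrow> Y \<subseteq> N)"
proof -
  define M where "M = {k \<in> S - A. (A, {k}) \<in> R}"
  have M: "M \<subseteq> S" "A \<inter> M = {}" by (auto simp: M_def)
  \<comment> \<open>\<open>E\<close> \<ge> \<open>A \<union> D\<close> would give \<open>A\<close>
    \<ge> \<open>E\<close> \<ge> \<open>A \<union> D\<close> \<ge> \<open>B\<close>, and likewise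
    with \<open>D\<close> and \<open>E\<close> exchanged; so both premises of (Ac) are
    strict.\<close>
  have join: "(A, D \<union> E) \<in> R \<and> (D \<union> E, A) \<notin> R"
    if "D \<subseteq> S" "E \<subseteq> S" "A \<inter> D = {}" "A \<inter> E = {}" "D \<inter> E = {}" "D \<noteq> {}" "E \<noteq> {}"
      "(A, D) \<in> R" "(A, E) \<in> R" for D E
  proof -
    have "(A \<union> D, E) \<in> R" "(A \<union> E, D) \<in> R"
      using mono_left[of A E "A \<union> D"] mono_left[of A D "A \<union> E"] that A by simp_all
    moreover have "(A \<union> D, B) \<in> R" "(A \<union> E, B) \<in> R"
      using that(1-7) A(1) by (auto intro!: maximal)
    then have "(E, A \<union> D) \<notin> R" "(D, A \<union> E) \<notin> R"
      using transitive[of E "A \<union> D" B] transitive[of D "A \<union> E" B]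
        transitive[of A E B] transitive[of A D B] that(8,9) A(2) by auto
    ultimately show ?thesis
      by (intro conjI accept[of A D E "A \<union> D" "A \<union> E"]) (use that(1-5) A(1) in simp_all)
  qed
  have below: "(A, D) \<in> R" if "D \<subseteq> M" for D
  proof -
    have "finite D" using finite_subset[OF that finite_subset[OF M(1) fin]] .
    then show ?thesis using that
    proof (induction D)
      case empty
      show ?case using subset_rel[of "{}" A] A by simp
    next
      case (insert k D)
      then have k: "(A, {k}) \<in> R" "k \<in> S - A" by (auto simp: M_def)
      show ?case
      proof (cases "D = {}")
        case False
        then show ?thesis using join[of "{k}" D] insert k M by auto
      qed (use k in simp)
    qed
  qed
  define N where "N = A \<union> M"
  have N: "N \<subseteq> S" "A \<subseteq> N" using A M by (auto simp: N_def)
  have closed: "Y \<subseteq> N" if XY: "(X, Y) \<in> R" "X \<subseteq> N" for X Y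
  proof (rule ccontr)
    assume "\<not> Y \<subseteq> N"
    define D where "D = Y - N"
    have D: "D \<noteq> {}" "A \<inter> D = {}" "M \<inter> D = {}" "D \<subseteq> S"
      using \<open>\<not> Y \<subseteq> N\<close> carrier[OF XY(1)] by (auto simp: D_def N_def)
    have ND: "(A \<union> M, D) \<in> R"
      using mono_right[OF mono_left[OF XY N(1)], of D] by (simp add: D_def N_def Diff_subset)
    have nAD: "(A, D) \<notin> R"
    proof
      assume "(A, D) \<in> R"
      then have "(A, {k}) \<in> R" if "k \<in> D" for k using mono_right[of A D "{k}"] that by simp
      then have "D \<subseteq> M" using D(2,4) by (auto simp: M_def)
      then show False using D by auto
    qed
    have ADM: "(A \<union> D, M) \<in> R" "(M, A \<union> D) \<notin> R"
      using mono_left[OF below[of M], of "A \<union> D"] mono_right[of M "A \<union> D" D]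
        transitive[OF below[of M], of D] nAD A(1) D(4) by auto
    \<comment> \<open>If \<open>D\<close> \<ge> \<open>A \<union> M\<close> fails, (Ac) gives
      \<open>A\<close> > \<open>M \<union> D\<close>, against \<open>nAD\<close>. If it holds, then
      \<open>D \<union> M\<close> > \<open>A\<close>, and (Ac) gives \<open>D\<close> >
      \<open>A \<union> M\<close>, against \<open>ND\<close>.\<close>
    show False
    proof (cases "(D, A \<union> M) \<in> R")
      case False
      then have "(A, M \<union> D) \<in> R"
        by (intro accept(1)[of A M D "A \<union> M" "A \<union> D"]) (use ND ADM A D M in simp_all)
      then show False using nAD mono_right[of A "M \<union> D" D] by simp
    next
      case True
      then have "(D \<union> M, A) \<in> R" "(A, D \<union> M) \<notin> R"
        using mono_left[of D A "D \<union> M"] mono_right[of D "A \<union> M" A] mono_right[of A "D \<union> M" D]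
          M(1) D(4) nAD by auto
      then have "(A \<union> M, D) \<notin> R"
        by (intro accept(2)[of D A M "A \<union> D" "D \<union> M"]) (use ADM A D M in auto)
      then show False using ND by simp
    qed
  qed
  have "N \<noteq> S"
  proof
    assume NS: "N = S"
    define I where "I = A \<inter> B"
    define G where "G = A - B"
    have IG: "G \<union> I = A" "G \<inter> I = {}" "G \<inter> M = {}" "M \<inter> I = {}" "G \<subseteq> S" "I \<subseteq> S"
      and SB: "S - B \<subseteq> G \<union> M" and BIM: "B \<subseteq> M \<union> I"
      using A B M NS by (auto simp: I_def G_def N_def)
    have nGB: "(G, B) \<notin> R" using mono_left[of G B A] A IG by auto
    show False
    proof (cases "(M, A) \<in> R")
      case True
      have "A \<noteq> S" using A subset_rel[OF B] by auto
      then have "M \<noteq> {}" using NS by (auto simp: N_def)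
      then obtain k where k: "k \<in> M" by blast
      \<comment> \<open>With a second point in \<open>M\<close>, \<open>join\<close> would give
        \<open>A\<close> > \<open>M\<close>. Since \<open>B\<close> is not inside \<open>A\<close>,
        the only point of \<open>M\<close> lies in \<open>B\<close>, which puts \<open>S - B\<close>
        inside \<open>G\<close>.\<close>
      have "M = {k}"
      proof (rule ccontr)
        assume "M \<noteq> {k}"
        moreover have "{k} \<union> (M - {k}) = M" using k by blast
        ultimately show False
          using join[of "{k}" "M - {k}"] below[of "{k}"] below[of "M - {k}"] k M True by auto
      qed
      moreover have "\<not> B \<subseteq> A" using A subset_rel[of B A] by auto
      ultimately have "S - B \<subseteq> G" using SB BIM IG by auto
      then show False using mono_left[OF dominated] IG nGB by simp
    next
      case False
      have "(G \<union> M, B) \<in> R" using mono_left[OF dominated SB] IG M by simp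
      \<comment> \<open>\<open>I\<close> \<ge> \<open>G \<union> M\<close> would give
        \<open>A\<close> \<ge> \<open>I\<close> \<ge> \<open>B\<close>. As
        \<open>G \<union> I = A\<close> > \<open>M\<close> too, (Ac) yields \<open>G\<close> >
        \<open>M \<union> I\<close>, which contains \<open>B\<close>.\<close>
      then have "(G \<union> M, I) \<in> R" "(I, G \<union> M) \<notin> R"
        using mono_right[of "G \<union> M" B I] mono_left[of I B A] transitive[of I "G \<union> M" B] A IG
        by (auto simp: I_def)
      then have "(G, M \<union> I) \<in> R"
        by (intro accept(1)[of G I M A "G \<union> M"])
          (use IG M False below[of M] in auto)
      then show False using nGB mono_right[OF _ BIM] by simp
    qed
  qed
  then have "N \<subset> S" using N by blast
  with N(2) show ?thesis by (intro exI[of _ N] conjI allI impI) (assumption | rule closed)+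
qed

end

section \<open>Constructions of complete acceptance preorders\<close>

text \<open>
  A ranking with levels \<open>U \<subseteq> V\<close>: on disjoint events only \<open>V\<close> discriminates, so \<open>U\<close> is not
  constrained by (Ac).
\<close>

lemma two_level_acceptance:
  assumes up: "\<And>X Y. X \<subseteq> Y \<Longrightarrow> Y \<subseteq> S \<Longrightarrow> X \<in> V \<Longrightarrow> Y \<in> V"
      "\<And>X Y. X \<subseteq> Y \<Longrightarrow> Y \<subseteq> S \<Longrightarrow> X \<in> U \<Longrightarrow> Y \<in> U"
    and sub: "U \<subseteq> V"
    and disj: "\<And>X Y. X \<in> U \<Longrightarrow> X \<inter> Y = {} \<Longrightarrow> Y \<notin> V"
    and V: "\<And>A B C. A \<inter> B = {} \<Longrightarrow> A \<inter> C = {} \<Longrightarrow> B \<inter> C = {} \<Longrightarrow> A \<union> B \<in> V \<Longrightarrow> A \<union> C \<in> V \<Longrightarrow>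
      B \<notin> V \<Longrightarrow> C \<notin> V \<Longrightarrow> A \<in> V \<and> B \<union> C \<notin> V"
    and Q: "Q = {(X, Y). X \<subseteq> S \<and> Y \<subseteq> S \<and> (Y \<in> V \<longrightarrow> X \<in> V) \<and> (Y \<in> U \<longrightarrow> X \<in> U)}"
  shows "acceptance_preorder S Q \<and> complete_on_events S Q"
proof
  \<comment> \<open>If \<open>X\<close> is strictly above a disjoint \<open>Y\<close> through
    \<open>U\<close>, then \<open>disj\<close> puts \<open>Y\<close> outside \<open>V\<close>, so
    \<open>V\<close> already separates them.\<close>
  have strict: "(X, Y) \<in> strict_part Q \<longleftrightarrow> X \<in> V \<and> Y \<notin> V"
    if "X \<subseteq> S" "Y \<subseteq> S" "X \<inter> Y = {}" for X Y
    using disj[of X Y] disj[of Y X] that sub by (auto simp: Q strict_part_def Int_commute)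
  have ac: "(A, B \<union> C) \<in> strict_part Q"
    if s: "A \<subseteq> S" "B \<subseteq> S" "C \<subseteq> S" and d: "A \<inter> B = {}" "A \<inter> C = {}" "B \<inter> C = {}"
      and *: "(A \<union> B, C) \<in> strict_part Q" "(A \<union> C, B) \<in> strict_part Q" for A B C
  proof -
    have "A \<union> B \<in> V" "C \<notin> V" "A \<union> C \<in> V" "B \<notin> V"
      using strict[of "A \<union> B" C] strict[of "A \<union> C" B] s d *
      by (auto simp: Int_Un_distrib2 Int_commute[of C B])
    then show ?thesis using V[of A B C] strict[of A "B \<union> C"] s d by (simp add: Int_Un_distrib)
  qed
  have tr: "Q \<subseteq> Pow S \<times> Pow S" "trans Q" by (auto simp: Q trans_def)
  have mono: "(B, A) \<in> Q" if "A \<subseteq> B" "B \<subseteq> S" for A B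
    using up that by (auto simp: Q)
  show "acceptance_preorder S Q"
    by (rule acceptance_preorderI) (rule tr | rule mono ac, assumption+)+
  show "complete_on_events S Q"
    using sub by (auto simp: Q complete_on_events_def)
qed

text \<open>Events not inside \<open>N\<close> form a single top class. In (Ac) the losing events
  \<open>B\<close> and \<open>C\<close> therefore lie inside \<open>N\<close>; either
  \<open>A\<close> does too and (Ac) for \<open>P\<close> applies, or \<open>A\<close> is in the top
  class and beats \<open>B \<union> C\<close>.\<close>

lemma add_top_class:
  assumes N: "N \<subseteq> S" and acc: "acceptance_preorder N P" and comp: "complete_on_events N P"
    and Q: "Q = {(X, Y). X \<subseteq> S \<and> Y \<subseteq> S \<and> (X \<subseteq> N \<longrightarrow> (X, Y) \<in> P)}"
  shows "acceptance_preorder S Q \<and> complete_on_events S Q"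
proof
  interpret acceptance N P by standard (rule acc)
  have ac: "(A, B \<union> C) \<in> strict_part Q"
    if s: "A \<subseteq> S" "B \<subseteq> S" "C \<subseteq> S" and d: "A \<inter> B = {}" "A \<inter> C = {}" "B \<inter> C = {}"
      and *: "(A \<union> B, C) \<in> strict_part Q" "(A \<union> C, B) \<in> strict_part Q" for A B C
  proof -
    have BC: "B \<subseteq> N" "C \<subseteq> N" using * by (auto simp: Q strict_part_def)
    show ?thesis
    proof (cases "A \<subseteq> N")
      case True
      then have "(A \<union> B, C) \<in> P" "(C, A \<union> B) \<notin> P" "(A \<union> C, B) \<in> P" "(B, A \<union> C) \<notin> P"
        using * BC s by (auto simp: Q strict_part_def)
      then have "(A, B \<union> C) \<in> P" "(B \<union> C, A) \<notin> P"
        using accept[of A B C "A \<union> B" "A \<union> C" "B \<union> C"] True BC d by simp_all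
      then show ?thesis using s BC True by (auto simp: Q strict_part_def)
    next
      case False
      then show ?thesis using s BC carrier[of "B \<union> C" A] by (auto simp: Q strict_part_def)
    qed
  qed
  have "(X, Z) \<in> Q" if "(X, Y) \<in> Q" "(Y, Z) \<in> Q" for X Y Z
    using that transitive[of X Y Z] carrier[of X Y] by (auto simp: Q)
  then have "trans Q" by (rule transI)
  moreover have "Q \<subseteq> Pow S \<times> Pow S" by (auto simp: Q)
  ultimately have tr: "Q \<subseteq> Pow S \<times> Pow S" "trans Q" by simp_all
  have mono: "(B, A) \<in> Q" if "A \<subseteq> B" "B \<subseteq> S" for A B
    using subset_rel that by (auto simp: Q)
  show "acceptance_preorder S Q"
    by (rule acceptance_preorderI) (rule tr | rule mono ac, assumption+)+
  show "complete_on_events S Q"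
    using comp by (auto simp: Q complete_on_events_def)
qed

lemma acceptance_preorder_restrict:
  assumes "acceptance_preorder S R" "N \<subseteq> S"
  shows "acceptance_preorder N (R \<inter> Pow N \<times> Pow N)"
proof -
  interpret acceptance S R by standard (rule assms)
  have ac: "(A, B \<union> C) \<in> strict_part (R \<inter> Pow N \<times> Pow N)"
    if "A \<subseteq> N" "B \<subseteq> N" "C \<subseteq> N" "A \<inter> B = {}" "A \<inter> C = {}" "B \<inter> C = {}"
      "(A \<union> B, C) \<in> strict_part (R \<inter> Pow N \<times> Pow N)"
      "(A \<union> C, B) \<in> strict_part (R \<inter> Pow N \<times> Pow N)" for A B C
    using accept[of A B C "A \<union> B" "A \<union> C" "B \<union> C"] that assms(2)
    by (auto simp: strict_part_def)
  have tr: "R \<inter> Pow N \<times> Pow N \<subseteq> Pow N \<times> Pow N" "trans (R \<inter> Pow N \<times> Pow N)"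
    using transitive by (auto simp: trans_def)
  have mono: "(B, A) \<in> R \<inter> Pow N \<times> Pow N" if "A \<subseteq> B" "B \<subseteq> N" for A B
    using subset_rel that assms(2) by auto
  show ?thesis
    by (rule acceptance_preorderI) (rule tr | rule mono ac, assumption+)+
qed

section \<open>Complete extensions omitting a given pair\<close>

lemma undominated_extension:
  assumes fin: "finite S" and acc: "acceptance_preorder S R"
    and AB: "A \<subseteq> S" "B \<subseteq> S" "(A, B) \<notin> R" and undom: "(S - B, B) \<notin> R"
  shows "\<exists>Q. acceptance_preorder S Q \<and> complete_on_events S Q \<and> R \<subseteq> Q \<and> (A, B) \<notin> Q"
proof -
  interpret acceptance S R by standard (rule acc)
  have "finite {J. J \<subseteq> B \<and> (S - J, J) \<notin> R}"
    by (rule finite_subset[of _ "Pow B"]) (use finite_subset[OF AB(2) fin] in auto)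
  then obtain J where "J \<in> {J. J \<subseteq> B \<and> (S - J, J) \<notin> R}"
    and "\<forall>J'\<in>{J. J \<subseteq> B \<and> (S - J, J) \<notin> R}. J' \<subseteq> J \<longrightarrow> J = J'"
    using finite_has_minimal2[of "{J. J \<subseteq> B \<and> (S - J, J) \<notin> R}" B] undom by auto
  then have J: "J \<subseteq> B" "(S - J, J) \<notin> R"
    and min: "\<And>J'. J' \<subseteq> B \<Longrightarrow> (S - J', J') \<notin> R \<Longrightarrow> J' \<subseteq> J \<Longrightarrow> J = J'"
    by simp_all
  have JS: "J \<subseteq> S" using J AB by blast
  have minimal: "(S - J', J') \<in> R" if "J' \<subset> J" for J' using min[of J'] that J(1) by auto
  have ne: "J \<noteq> {}" using J subset_rel[of "{}" S] by auto
  define W where "W = {X. X \<subseteq> S \<and> (X, B) \<in> R}"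
  have BW: "B \<in> W" "A \<notin> W" using AB subset_rel[of B B] by (auto simp: W_def)
  have W_up: "X \<in> W" if "(X, Y) \<in> R" "Y \<in> W" for X Y
    using that carrier[of X Y] transitive[of X Y B] by (simp add: W_def)
  show ?thesis
  proof (cases "\<forall>X. (X, J) \<in> R \<longrightarrow> J \<subseteq> X")
    case True
    define V where "V = {X. J \<subseteq> X}"
    \<comment> \<open>Since \<open>J \<subseteq> B\<close>, whatever is \<ge> \<open>B\<close> is
      \<ge> \<open>J\<close> and so contains \<open>J\<close>.\<close>
    have WV: "W \<subseteq> V"
      using True mono_right[OF _ J(1)] by (auto simp: W_def V_def)
    define Q where "Q = {(X, Y). X \<subseteq> S \<and> Y \<subseteq> S \<and> (Y \<in> V \<longrightarrow> X \<in> V) \<and> (Y \<in> W \<longrightarrow> X \<in> W)}"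
    have "acceptance_preorder S Q \<and> complete_on_events S Q"
    proof (rule two_level_acceptance[OF _ _ WV _ _ Q_def])
      fix X Y
      show "X \<subseteq> Y \<Longrightarrow> Y \<subseteq> S \<Longrightarrow> X \<in> V \<Longrightarrow> Y \<in> V" by (auto simp: V_def)
      show "X \<subseteq> Y \<Longrightarrow> Y \<subseteq> S \<Longrightarrow> X \<in> W \<Longrightarrow> Y \<in> W" using W_up[OF subset_rel] by blast
      show "X \<in> W \<Longrightarrow> X \<inter> Y = {} \<Longrightarrow> Y \<notin> V" using WV ne by (auto simp: V_def)
    qed (use ne in \<open>auto simp: V_def\<close>)
    moreover have "R \<subseteq> Q"
    proof clarify
      fix X Y assume XY: "(X, Y) \<in> R"
      then have "X \<in> V" if "Y \<in> V" using True mono_right that by (auto simp: V_def)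
      then show "(X, Y) \<in> Q" using XY W_up carrier by (auto simp: Q_def)
    qed
    moreover have "(A, B) \<notin> Q" using BW by (auto simp: Q_def)
    ultimately show ?thesis by blast
  next
    case False
    then obtain X0 where "(X0, J) \<in> R" "\<not> J \<subseteq> X0" by blast
    note struct = meets_rel[OF JS J(2) minimal this] rel_not_contains[OF JS J(2) minimal this]
    define V where "V = {X. X \<inter> J \<noteq> {}}"
    \<comment> \<open>If \<open>A\<close> misses \<open>J\<close>, then \<open>V\<close> alone
      separates \<open>B\<close> from \<open>A\<close>. Otherwise \<open>A\<close> \<ge>
      \<open>J\<close>, and an \<open>X\<close> \<ge> \<open>B\<close> not containing
      \<open>J\<close> would give \<open>A\<close> \<ge> \<open>J\<close> \<ge> \<open>X\<close>
      \<ge> \<open>B\<close>; so \<open>W\<close> consists of supersets of \<open>J\<close>, as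
      \<open>disj\<close> of \<open>two_level_acceptance\<close> requires.\<close>
    define U where "U = (if A \<inter> J = {} then {} else W)"
    have V_rel: "X \<in> V" if "(X, J) \<in> R" for X
      using that J mono_left[of X J "S - J"] carrier[OF that] by (auto simp: V_def)
    have U_J: "J \<subseteq> X" if "X \<in> U" for X
    proof (rule ccontr)
      assume n: "\<not> J \<subseteq> X"
      have X: "X \<in> W" "A \<inter> J \<noteq> {}" using that by (auto simp: U_def split: if_splits)
      then have "(J, X) \<in> R" using struct(2) n by (auto simp: W_def)
      then have "(A, B) \<in> R" using struct(1)[of A] X AB(1) transitive[of A J X] transitive[of A X B] by (simp add: W_def)
      then show False using AB(3) by simp
    qed
    have UV: "U \<subseteq> V" using U_J ne by (auto simp: V_def)
    have U_up: "X \<in> U" if "(X, Y) \<in> R" "Y \<in> U" for X Y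
      using W_up that by (auto simp: U_def split: if_splits)
    define Q where "Q = {(X, Y). X \<subseteq> S \<and> Y \<subseteq> S \<and> (Y \<in> V \<longrightarrow> X \<in> V) \<and> (Y \<in> U \<longrightarrow> X \<in> U)}"
    have "acceptance_preorder S Q \<and> complete_on_events S Q"
    proof (rule two_level_acceptance[OF _ _ UV _ _ Q_def])
      fix X Y
      show "X \<subseteq> Y \<Longrightarrow> Y \<subseteq> S \<Longrightarrow> X \<in> V \<Longrightarrow> Y \<in> V" by (auto simp: V_def)
      show "X \<subseteq> Y \<Longrightarrow> Y \<subseteq> S \<Longrightarrow> X \<in> U \<Longrightarrow> Y \<in> U" using U_up[OF subset_rel] by blast
      show "X \<in> U \<Longrightarrow> X \<inter> Y = {} \<Longrightarrow> Y \<notin> V" using U_J by (auto simp: V_def)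
    qed (auto simp: V_def)
    moreover have "R \<subseteq> Q"
    proof clarify
      fix X Y assume XY: "(X, Y) \<in> R"
      have "X \<in> V" if "Y \<in> V"
        using V_rel transitive[OF XY] struct(1)[of Y] that carrier[OF XY] by (auto simp: V_def)
      then show "(X, Y) \<in> Q" using XY U_up carrier by (auto simp: Q_def)
    qed
    moreover have "(A, B) \<notin> Q"
      using BW J ne by (cases "A \<inter> J = {}") (auto simp: Q_def U_def V_def)
    ultimately show ?thesis by blast
  qed
qed

lemma complete_extension:
  assumes "finite S" "acceptance_preorder S R" "A \<subseteq> S" "B \<subseteq> S" "(A, B) \<notin> R"
  shows "\<exists>Q. acceptance_preorder S Q \<and> complete_on_events S Q \<and> R \<subseteq> Q \<and> (A, B) \<notin> Q"
  using assms
proof (induction S arbitrary: R rule: finite_psubset_induct)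
  case (psubset S)
  note acc = psubset.prems(1) and AB = psubset.prems(2-4)
  interpret acceptance S R by standard (rule acc)
  show ?case
  proof (cases "(S - B, B) \<in> R")
    case False
    then show ?thesis using undominated_extension[OF psubset.hyps acc AB] by blast
  next
    case True
    have "finite {X. A \<subseteq> X \<and> X \<subseteq> S \<and> (X, B) \<notin> R}"
      by (rule finite_subset[of _ "Pow S"]) (use psubset.hyps in auto)
    then obtain A' where "A' \<in> {X. A \<subseteq> X \<and> X \<subseteq> S \<and> (X, B) \<notin> R}"
      and "\<forall>X\<in>{X. A \<subseteq> X \<and> X \<subseteq> S \<and> (X, B) \<notin> R}. A' \<subseteq> X \<longrightarrow> A' = X"
      using finite_has_maximal2[of "{X. A \<subseteq> X \<and> X \<subseteq> S \<and> (X, B) \<notin> R}" A] AB by auto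
    then have A': "A \<subseteq> A'" "A' \<subseteq> S" "(A', B) \<notin> R"
      and max: "\<And>X. A \<subseteq> X \<Longrightarrow> X \<subseteq> S \<Longrightarrow> (X, B) \<notin> R \<Longrightarrow> A' \<subseteq> X \<Longrightarrow> A' = X"
      by simp_all
    have "(X, B) \<in> R" if "A' \<subset> X" "X \<subseteq> S" for X
      using max[of X] that A'(1) by auto
    then obtain N where N: "A' \<subseteq> N" "N \<subset> S"
      and closed: "\<And>X Y. (X, Y) \<in> R \<Longrightarrow> X \<subseteq> N \<Longrightarrow> Y \<subseteq> N"
      using lower_closed_above_maximal[OF psubset.hyps A'(2,3) AB(2) _ True] by blast
    define RN where "RN = R \<inter> Pow N \<times> Pow N"
    have accN: "acceptance_preorder N RN"
      unfolding RN_def using acceptance_preorder_restrict[OF acc] N by blast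
    obtain P where P: "acceptance_preorder N P" "complete_on_events N P" "RN \<subseteq> P" "(A, B) \<notin> P"
    proof (cases "B \<subseteq> N")
      case True
      have "A \<subseteq> N" "(A, B) \<notin> RN" using A'(1) N(1) AB(3) by (auto simp: RN_def)
      then show thesis using psubset.IH[OF N(2) accN _ True] that by auto
    next
      \<comment> \<open>Here \<open>B\<close> falls into the top class while \<open>A\<close> lies
        inside \<open>N\<close>, so all events inside \<open>N\<close> may be made
        equivalent.\<close>
      case False
      have "acceptance_preorder N (Pow N \<times> Pow N)"
        by (auto simp: acceptance_preorder_def strict_part_def trans_def)
      moreover have "complete_on_events N (Pow N \<times> Pow N)"
        by (auto simp: complete_on_events_def)
      ultimately show thesis using False that by (auto simp: RN_def)
    qed
    define Q where "Q = {(X, Y). X \<subseteq> S \<and> Y \<subseteq> S \<and> (X \<subseteq> N \<longrightarrow> (X, Y) \<in> P)}"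
    have "acceptance_preorder S Q \<and> complete_on_events S Q"
      using add_top_class[OF _ P(1,2) Q_def] N by blast
    moreover have "R \<subseteq> Q"
    proof clarify
      fix X Y assume XY: "(X, Y) \<in> R"
      then have "(X, Y) \<in> RN" if "X \<subseteq> N" using closed[OF XY that] that by (simp add: RN_def)
      then show "(X, Y) \<in> Q" using carrier[OF XY] P(3) by (auto simp: Q_def)
    qed
    moreover have "(A, B) \<notin> Q" using P(4) A' N by (auto simp: Q_def)
    ultimately show ?thesis by blast
  qed
qed

theorem theorem2:
  fixes S :: "'a set" and R :: "'a set rel"
  assumes "finite S"
    and "acceptance_preorder S R"
  shows "\<exists>F :: 'a set rel set.
           (\<forall>Q\<in>F. acceptance_preorder S Q \<and> complete_on_events S Q) \<and>
           (\<forall>A\<subseteq>S. \<forall>B\<subseteq>S. (A, B) \<in> R \<longleftrightarrow> (\<forall>Q\<in>F. (A, B) \<in> Q))"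
proof (intro exI conjI)
  \<comment> \<open>The largest possible choice: every member of a representing family contains
    \<open>R\<close>.\<close>
  let ?F = "{Q. acceptance_preorder S Q \<and> complete_on_events S Q \<and> R \<subseteq> Q}"
  show "\<forall>Q\<in>?F. acceptance_preorder S Q \<and> complete_on_events S Q" by blast
  show "\<forall>A\<subseteq>S. \<forall>B\<subseteq>S. (A, B) \<in> R \<longleftrightarrow> (\<forall>Q\<in>?F. (A, B) \<in> Q)"
  proof (intro allI impI iffI)
    fix A B assume AB: "A \<subseteq> S" "B \<subseteq> S"
    show "\<forall>Q\<in>?F. (A, B) \<in> Q" if "(A, B) \<in> R" using that by auto
    show "(A, B) \<in> R" if *: "\<forall>Q\<in>?F. (A, B) \<in> Q"
    proof (rule ccontr)
      assume "(A, B) \<notin> R"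
      then obtain Q where "acceptance_preorder S Q" "complete_on_events S Q" "R \<subseteq> Q" "(A, B) \<notin> Q"
        using complete_extension[OF assms AB] by auto
      then show False using * by simp
    qed
  qed
qed

end
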